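(* Let $n_c,n_s\ge 1$ and $n=n_c+n_s$. Let $A,X\in\mathbb{R}^{n\times n}$ be symmetric positive definite, let $R\in\mathbb{R}^{n_c\times n}$ be such that there exists $P\in\mathbb{R}^{n\times n_c}$ with $RP=I_{n_c}$, and let $S\in\mathbb{R}^{n\times n_s}$ have full column rank with $RS=0$. Then there is a unique ideal interpolation $P_\star$ belonging to $\mathbb{P}_0=\{P\in\mathbb{R}^{n\times n_c}:RP=I_{n_c},\ P^TAS=0\}$, and it is given by $$P_\star=A^{-1}R^T(RA^{-1}R^T)^{-1}.$$
   Context: All matrices are real and $(\cdot,\cdot)$ is the Euclidean inner product. $A,X,R,S$ are fixed. For $P\in\mathbb{R}^{n\times n_c}$ with $RP=I_{n_c}$, $Q=PR$, and $\mathbf{e}\in\mathbb{R}^n\setminus\{0\}$ put $$\mu_X(Q,\mathbf{e})=\frac{\big(X(I-Q)\mathbf{e},(I-Q)\mathbf{e}\big)}{(A\mathbf{e},\mathbf{e})}.$$ A matrix $P_\star\in\mathbb{R}^{n\times n_c}$ with $RP_\star=I_{n_c}$ is called an ideal interpolation if it minimizes $\max_{\mathbf{e}\neq0}\mu_X(PR,\mathbf{e})$ over all $P\in\mathbb{R}^{n\times n_c}$ with $RP=I_{n_c}$. *)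

theory Defs
  imports "HOL-Analysis.Analysis"
begin

definition spd :: "real ^ 'n ^ 'n \<Rightarrow> bool" where
  "spd A \<longleftrightarrow> transpose A = A \<and> (\<forall>v. v \<noteq> 0 \<longrightarrow> (A *v v) \<bullet> v > 0)"

definition mu ::
  "real ^ 'n ^ 'n \<Rightarrow> real ^ 'n ^ 'n \<Rightarrow> real ^ 'n ^ 'n \<Rightarrow> real ^ 'n \<Rightarrow> real" where
  "mu A X Q e =
     ((X *v ((mat 1 - Q) *v e)) \<bullet> ((mat 1 - Q) *v e)) / ((A *v e) \<bullet> e)"

text \<open>The supremum below is a maximum when \<open>A\<close> is positive definite; see \<open>max_mu_attained\<close>
  and \<open>mu_le_max_mu\<close>.\<close>

definition max_mu :: "real ^ 'n ^ 'n \<Rightarrow> real ^ 'n ^ 'n \<Rightarrow> real ^ 'n ^ 'n \<Rightarrow> real" where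
  "max_mu A X Q = (SUP e\<in>{e. e \<noteq> 0}. mu A X Q e)"

definition ideal_interpolation ::
  "real ^ 'n ^ 'n \<Rightarrow> real ^ 'n ^ 'n \<Rightarrow> real ^ 'n ^ 'c \<Rightarrow> real ^ 'c ^ 'n \<Rightarrow> bool" where
  "ideal_interpolation A X R P \<longleftrightarrow>
     R ** P = mat 1 \<and>
     (\<forall>P'. R ** P' = mat 1 \<longrightarrow> max_mu A X (P ** R) \<le> max_mu A X (P' ** R))"

definition P0 ::
  "real ^ 'n ^ 'n \<Rightarrow> real ^ 'n ^ 'c \<Rightarrow> real ^ 's ^ 'n \<Rightarrow> (real ^ 'c ^ 'n) set" where
  "P0 A R S = {P. R ** P = mat 1 \<and> transpose P ** A ** S = 0}"

lemma mu_has_maximum: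
  fixes A X Q :: "real ^ 'n ^ 'n"
  assumes "spd A"
  shows "\<exists>e. e \<noteq> 0 \<and> (\<forall>e'. e' \<noteq> 0 \<longrightarrow> mu A X Q e' \<le> mu A X Q e)"
proof -
  have ne: "sphere (0 :: real ^ 'n) 1 \<noteq> {}"
    by simp
  have "continuous_on (sphere 0 1) (mu A X Q)"
    unfolding mu_def matrix_vector_mul_assoc
  proof (intro continuous_intros ballI)
    fix e :: "real ^ 'n" assume "e \<in> sphere 0 1"
    then have "e \<noteq> 0" by auto
    then show "(A *v e) \<bullet> e \<noteq> 0" using assms by (force simp: spd_def)
  qed
  from continuous_attains_sup[OF compact_sphere ne this] obtain e
    where e: "e \<in> sphere 0 1" "\<And>d. d \<in> sphere 0 1 \<Longrightarrow> mu A X Q d \<le> mu A X Q e"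
    by blast
  have scale: "mu A X Q (c *\<^sub>R d) = mu A X Q d" if "c \<noteq> 0" for c d
    using that by (simp add: mu_def matrix_vector_mult_scaleR)
  have "mu A X Q d \<le> mu A X Q e" if "d \<noteq> 0" for d
  proof -
    have "mu A X Q (inverse (norm d) *\<^sub>R d) \<le> mu A X Q e"
      using that by (intro e(2)) simp
    then show ?thesis using scale[of "inverse (norm d)" d] that by simp
  qed
  moreover have "e \<noteq> 0" using e(1) by auto
  ultimately show ?thesis by blast
qed

lemma mu_le_max_mu:
  assumes "spd A" and "e \<noteq> 0"
  shows "mu A X Q e \<le> max_mu A X Q"
proof -
  have "bdd_above (mu A X Q ` {e. e \<noteq> 0})"
    using mu_has_maximum[OF assms(1), of X Q] by (auto simp: bdd_above_def)
  then show ?thesis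
    using assms(2) unfolding max_mu_def by (intro cSUP_upper) auto
qed

lemma max_mu_attained:
  assumes "spd A"
  shows "\<exists>e. e \<noteq> 0 \<and> mu A X Q e = max_mu A X Q"
proof -
  obtain e where e: "e \<noteq> 0" "\<And>d. d \<noteq> 0 \<Longrightarrow> mu A X Q d \<le> mu A X Q e"
    using mu_has_maximum[OF assms] by blast
  have "max_mu A X Q \<le> mu A X Q e"
    unfolding max_mu_def using e by (intro cSUP_least) auto
  with mu_le_max_mu[OF assms e(1), of X Q] e(1) show ?thesis by (metis antisym)
qed

end

theory Submission imports Defs begin

text \<open>The kernel of \<open>R\<close> equals the range of \<open>S\<close> by dimension count, so membership in \<open>P0\<close> says that the range
  of \<open>P\<close> is \<open>A\<close>-orthogonal to ker \<open>R\<close>; positive definiteness leaves room for only one such \<open>P\<close>, and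
  \<open>A\<inverse>R\<^sup>T(RA\<inverse>R\<^sup>T)\<inverse>\<close> is one. For it, \<open>f = (I - PR)e\<close> is the \<open>A\<close>-orthogonal projection of
  \<open>e\<close> onto ker \<open>R\<close>, so \<open>mu\<close> at \<open>e\<close> is at most its value at \<open>f\<close>; but every coarse interpolation
  has \<open>(I - P'R)f = f\<close>, so it sees that same value, and \<open>P\<close> is optimal.\<close>

lemma inner_transpose_mult:
  fixes M :: "real ^ 'n ^ 'm"
  shows "(transpose M *v x) \<bullet> y = x \<bullet> (M *v y)"
  by (simp add: dot_lmul_matrix)

lemma spd_inner_commute:
  assumes "spd A"
  shows "(A *v x) \<bullet> y = (A *v y) \<bullet> x"
  using assms inner_transpose_mult[of A x y] by (simp add: spd_def inner_commute)

lemma spd_nonneg: "spd A \<Longrightarrow> 0 \<le> (A *v x) \<bullet> x"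
  by (cases "x = 0") (auto simp: spd_def less_imp_le)

lemma invertible_if_kernel_trivial:
  fixes M :: "real ^ 'n ^ 'n"
  assumes "\<And>x. M *v x = 0 \<Longrightarrow> x = 0"
  shows "invertible M"
  using assms by (metis invertible_left_inverse matrix_left_invertible_ker)

lemma matrix_inv_right:
  assumes "invertible M"
  shows "M ** matrix_inv M = mat 1"
  using someI_ex[OF assms[unfolded invertible_def]] by (simp add: matrix_inv_def)

lemma spd_invertible:
  fixes A :: "real ^ 'n ^ 'n"
  assumes "spd A"
  shows "invertible A"
proof (rule invertible_if_kernel_trivial)
  fix x assume "A *v x = 0"
  then show "x = 0" using assms unfolding spd_def by (metis inner_zero_left less_irrefl)
qed

text \<open>Pairing \<open>transpose R *v v\<close> with \<open>P *v v\<close> gives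
  \<open>v \<bullet> v\<close>.\<close>

lemma transpose_mult_eq_0_imp:
  fixes R :: "real ^ 'n ^ 'c" and P :: "real ^ 'c ^ 'n"
  assumes "R ** P = mat 1" and "transpose R *v v = 0"
  shows "v = 0"
proof -
  have "v \<bullet> (R *v (P *v v)) = 0"
    using assms(2) inner_transpose_mult[of R v "P *v v"] by simp
  then show ?thesis using assms(1) by (simp add: matrix_vector_mul_assoc)
qed

text \<open>The right inverse \<open>P\<close> makes \<open>transpose R\<close> injective, so its
  range has dimension \<open>CARD('c)\<close>. The kernel of \<open>R\<close> is the orthogonal
  complement of that range and so has dimension \<open>CARD('s)\<close>, the rank of
  \<open>S\<close>; the inclusion given by \<open>R ** S = 0\<close> is then an equality.\<close>

lemma kernel_eq_range:
  fixes R :: "real ^ 'n ^ 'c" and S :: "real ^ 's ^ 'n" and P :: "real ^ 'c ^ 'n"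
  assumes card: "CARD('n) = CARD('c) + CARD('s)" and RP: "R ** P = mat 1"
    and rank: "rank S = CARD('s)" and RS: "R ** S = 0"
  shows "{x. R *v x = 0} = range ((*v) S)"
proof -
  have sub: "subspace (range ((*v) (transpose R)))"
    by (intro linear_subspace_image matrix_vector_mul_linear subspace_UNIV)
  have "transpose P ** transpose R = mat 1"
    using RP by (metis matrix_transpose_mul transpose_mat)
  then have "inj ((*v) (transpose R))"
    by (metis matrix_left_invertible_injective)
  then have dimR: "dim (range ((*v) (transpose R))) = CARD('c)"
    using full_rank_injective[of "transpose R"] rank_dim_range[of "transpose R"] by simp
  have "{y \<in> UNIV. \<forall>x \<in> range ((*v) (transpose R)). orthogonal x y} = {y. R *v y = 0}"
  proof -
    \<comment> \<open>Moving the transpose across turns the left side into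
      \<open>x \<bullet> (R *v y) = 0\<close> for all \<open>x\<close>; take
      \<open>x = R *v y\<close>.\<close>
    have "(\<forall>x. orthogonal (transpose R *v x) y) \<longleftrightarrow> R *v y = 0" for y
      unfolding orthogonal_def inner_transpose_mult by (metis inner_eq_zero_iff inner_zero_right)
    then show ?thesis by auto
  qed
  then have "dim {y. R *v y = 0} + CARD('c) = CARD('n)"
    using dim_subspace_orthogonal_to_vectors[OF sub subspace_UNIV] dimR by simp
  then have "dim {y. R *v y = 0} \<le> dim (range ((*v) S))"
    using card rank by (simp add: rank_dim_range)
  moreover have "range ((*v) S) \<subseteq> {y. R *v y = 0}"
    using RS by (auto simp: matrix_vector_mul_assoc)
  moreover have "subspace {y. R *v y = 0}"
    by (auto simp: subspace_def matrix_vector_right_distrib matrix_vector_mult_scaleR)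
  moreover have "subspace (range ((*v) S))"
    by (intro linear_subspace_image matrix_vector_mul_linear subspace_UNIV)
  ultimately show ?thesis using subspace_dim_equal by metis
qed

lemma P0_A_orthogonal:
  assumes "P \<in> P0 A R S" and "spd A"
  shows "(A *v (P *v v)) \<bullet> (S *v z) = 0"
proof -
  have "(transpose P ** A ** S) *v z = 0"
    using assms(1) by (simp add: P0_def)
  then have "v \<bullet> (transpose P *v (A *v (S *v z))) = 0"
    by (simp only: matrix_vector_mul_assoc matrix_mul_assoc inner_zero_right)
  then have "(A *v (S *v z)) \<bullet> (P *v v) = 0"
    by (metis inner_commute inner_transpose_mult)
  then show ?thesis
    using assms(2) by (metis spd_inner_commute)
qed

text \<open>\<open>P *v v\<close> and \<open>P' *v v\<close> have the same image under
  \<open>R\<close>, so their difference lies in the range of \<open>S\<close>. It is also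
  \<open>A\<close>-orthogonal to that range, hence to itself.\<close>

lemma P0_unique:
  assumes A: "spd A" and ker: "{x. R *v x = 0} = range ((*v) S)"
    and P: "P \<in> P0 A R S" and P': "P' \<in> P0 A R S"
  shows "P = P'"
proof -
  have "P *v v = P' *v v" for v
  proof -
    define d where "d = P *v v - P' *v v"
    have "R *v d = 0"
      using P P' by (simp add: d_def P0_def matrix_vector_mult_diff_distrib matrix_vector_mul_assoc)
    then obtain z where z: "d = S *v z" using ker by auto
    have "(A *v d) \<bullet> (S *v z) = 0"
      using P0_A_orthogonal[OF P A] P0_A_orthogonal[OF P' A]
      by (simp add: d_def matrix_vector_mult_diff_distrib inner_diff_left)
    then have "(A *v d) \<bullet> d = 0" by (simp only: z)
    then have "d = 0" using A by (force simp: spd_def)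
    then show ?thesis by (simp add: d_def)
  qed
  then show ?thesis by (simp add: matrix_eq)
qed

text \<open>The maximum for \<open>P\<close> is attained at some \<open>e\<close>, so one comparison
  suffices; \<open>P'\<close> is tested at \<open>f\<close>, not at \<open>e\<close>.\<close>

lemma A_orthogonal_interpolation_ideal:
  fixes A X :: "real ^ 'n ^ 'n" and R :: "real ^ 'n ^ 'c" and P :: "real ^ 'c ^ 'n"
  assumes A: "spd A" and X: "spd X" and RP: "R ** P = mat 1"
    and orth: "\<And>v f. R *v f = 0 \<Longrightarrow> (A *v (P *v v)) \<bullet> f = 0"
  shows "ideal_interpolation A X R P"
  unfolding ideal_interpolation_def
proof (intro conjI allI impI)
  fix P' :: "real ^ 'c ^ 'n" assume "R ** P' = mat 1"
  obtain e where e: "e \<noteq> 0" "mu A X (P ** R) e = max_mu A X (P ** R)"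
    using max_mu_attained[OF A] by blast
  define f where "f = (mat 1 - P ** R) *v e"
  have split: "e = P *v (R *v e) + f"
    by (simp add: f_def matrix_vector_mult_diff_rdistrib matrix_vector_mul_assoc)
  have Rf: "R *v f = 0"
    using RP by (simp add: f_def matrix_vector_mult_diff_rdistrib matrix_vector_mult_diff_distrib
        matrix_vector_mul_assoc matrix_mul_assoc)
  have mu_ker: "mu A X (P' ** R) f = ((X *v f) \<bullet> f) / ((A *v f) \<bullet> f)"
    using Rf by (simp add: mu_def matrix_vector_mult_diff_rdistrib flip: matrix_vector_mul_assoc)
  show "max_mu A X (P ** R) \<le> max_mu A X (P' ** R)"
  proof (cases "f = 0")
    \<comment> \<open>Here \<open>f\<close> is no admissible test vector, but the maximum for
      \<open>P\<close> is 0 and \<open>mu\<close> is never negative.\<close>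
    case True
    have "0 \<le> mu A X (P' ** R) e"
      unfolding mu_def using spd_nonneg[OF A] spd_nonneg[OF X] by (intro divide_nonneg_nonneg)
    also have "\<dots> \<le> max_mu A X (P' ** R)" by (rule mu_le_max_mu[OF A e(1)])
    finally show ?thesis using True e(2) by (simp add: mu_def flip: f_def)
  next
    case False
    let ?c = "P *v (R *v e)"
    have "(A *v e) \<bullet> e = (A *v (?c + f)) \<bullet> (?c + f)" using split by simp
    \<comment> \<open>Pythagoras in the \<open>A\<close>-inner product: both cross terms
      vanish.\<close>
    also have "\<dots> = (A *v ?c) \<bullet> ?c + (A *v f) \<bullet> f"
      using orth[OF Rf] spd_inner_commute[OF A, of f ?c]
      by (simp add: matrix_vector_right_distrib inner_add_left inner_add_right)
    finally have "(A *v f) \<bullet> f \<le> (A *v e) \<bullet> e"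
      using spd_nonneg[OF A, of ?c] by simp
    moreover have "0 < (A *v f) \<bullet> f" using A False by (simp add: spd_def)
    \<comment> \<open>Both quotients have numerator \<open>(X *v f) \<bullet> f\<close>; only the
      denominator shrinks from \<open>e\<close> to \<open>f\<close>.\<close>
    ultimately have "mu A X (P ** R) e \<le> mu A X (P' ** R) f"
      unfolding mu_ker unfolding mu_def f_def[symmetric]
      using spd_nonneg[OF X] by (intro divide_left_mono) auto
    also have "\<dots> \<le> max_mu A X (P' ** R)" by (rule mu_le_max_mu[OF A False])
    finally show ?thesis by (simp add: e(2))
  qed
qed (rule RP)

theorem theorem4p1:
  fixes A X :: "real ^ 'n ^ 'n"
    and R :: "real ^ 'n ^ 'c"
    and S :: "real ^ 's ^ 'n"
  assumes "CARD('n) = CARD('c) + CARD('s)"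
    and "spd A"
    and "spd X"
    and "\<exists>P :: real ^ 'c ^ 'n. R ** P = mat 1"
    and "rank S = CARD('s)"
    and "R ** S = 0"
  shows "invertible A \<and> invertible (R ** matrix_inv A ** transpose R) \<and>
    (\<exists>!P. ideal_interpolation A X R P \<and> P \<in> P0 A R S) \<and>
    (\<forall>P. ideal_interpolation A X R P \<and> P \<in> P0 A R S \<longrightarrow>
       P = matrix_inv A ** transpose R ** matrix_inv (R ** matrix_inv A ** transpose R))"
proof -
  note A = assms(2)
  obtain P' :: "real ^ 'c ^ 'n" where P': "R ** P' = mat 1" using assms(4) by blast
  have invA: "invertible A" by (rule spd_invertible[OF A])
  define B where "B = matrix_inv A"
  have AB: "A ** B = mat 1" unfolding B_def by (rule matrix_inv_right[OF invA])
  define M where "M = R ** B ** transpose R"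
  have invM: "invertible M"
  proof (rule invertible_if_kernel_trivial)
    fix v assume Mv: "M *v v = 0"
    \<comment> \<open>With this \<open>w\<close>, \<open>R *v w = M *v v = 0\<close>, while
      \<open>(A *v w) \<bullet> w = v \<bullet> (R *v w)\<close>.\<close>
    define w where "w = B *v (transpose R *v v)"
    have Aw: "A *v w = transpose R *v v"
      unfolding w_def by (subst matrix_vector_mul_assoc) (simp only: AB matrix_vector_mul_lid)
    have "R *v w = 0"
      using Mv by (simp only: M_def w_def matrix_vector_mul_assoc matrix_mul_assoc)
    then have "(A *v w) \<bullet> w = 0"
      unfolding Aw inner_transpose_mult by simp
    then have "w = 0" using A by (force simp: spd_def)
    then have "transpose R *v v = 0" using Aw by (metis matrix_vector_mult_0_right)
    then show "v = 0" by (rule transpose_mult_eq_0_imp[OF P'])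
  qed
  define P where "P = B ** transpose R ** matrix_inv M"
  have RP: "R ** P = mat 1"
    using matrix_inv_right[OF invM] by (simp only: P_def M_def matrix_mul_assoc)
  \<comment> \<open>\<open>A\<close> carries the range of \<open>P\<close> into that of
    \<open>transpose R\<close>, which is orthogonal to the kernel of \<open>R\<close>. Both
    optimality and membership in \<open>P0\<close> rest on this identity.\<close>
  have "A ** P = transpose R ** matrix_inv M"
    by (simp only: P_def matrix_mul_assoc AB matrix_mul_lid)
  then have AP: "A *v (P *v v) = transpose R *v (matrix_inv M *v v)" for v
    by (simp only: matrix_vector_mul_assoc)
  have orth: "(A *v (P *v v)) \<bullet> f = 0" if "R *v f = 0" for v f
    unfolding AP inner_transpose_mult that by simp
  have ideal: "ideal_interpolation A X R P"
    using A assms(3) RP orth by (rule A_orthogonal_interpolation_ideal)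
  \<comment> \<open>By symmetry of \<open>A\<close> the product ends in the factor \<open>R\<close>,
    which annihilates \<open>S\<close>.\<close>
  have "transpose P ** A = transpose (A ** P)"
    using A by (simp add: matrix_transpose_mul spd_def)
  also have "\<dots> = transpose (matrix_inv M) ** R"
    by (simp add: \<open>A ** P = _\<close> matrix_transpose_mul)
  finally have "transpose P ** A ** S = 0"
    using assms(6) by (simp flip: matrix_mul_assoc)
  then have P0: "P \<in> P0 A R S" using RP by (simp add: P0_def)
  have unique: "P'' = P" if "P'' \<in> P0 A R S" for P''
    using P0_unique[OF A kernel_eq_range[OF assms(1) P' assms(5,6)] that P0] .
  show ?thesis
    using invA invM ideal P0 unique
    unfolding P_def M_def B_def by blast
qed

end
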